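(* Let $G=K_{n_1,n_2,\ldots,n_k}$ be a complete $k$-partite graph of order $n$, where $k\geq 2$ and $n_1\leq n_2\leq \cdots \leq n_k$. Then $rd(G)=n-n_2$ if $n_1=1$, and $rd(G)=n-n_1$ if $n_1\geq 2$.
   Context: All graphs are simple, finite and undirected. For an edge-coloring of a graph $G$ (adjacent edges may receive the same color), an edge-cut $R$ is a rainbow cut if no two edges of $R$ have the same color; it is a $u$-$v$ rainbow cut if $u$ and $v$ lie in different components of $G-R$. An edge-colored graph is rainbow disconnected if for every two vertices $u,v$ there is a $u$-$v$ rainbow cut. For a nontrivial connected graph $G$, $rd(G)$ (the rainbow disconnection number) is the smallest number of colors in an edge-coloring making $G$ rainbow disconnected. *)

theory Defs
  imports Main "HOL-Library.Disjoint_Sets"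
begin

text \<open>Graphs are given by a vertex set \<open>V\<close> and a set \<open>E\<close> of edges, each edge being a
  two-element subset of \<open>V\<close>.\<close>

definition simple_graph :: "'a set \<Rightarrow> 'a set set \<Rightarrow> bool" where
  "simple_graph V E \<longleftrightarrow> finite V \<and> (\<forall>e\<in>E. e \<subseteq> V \<and> card e = 2)"

definition adj :: "'a set set \<Rightarrow> 'a rel" where
  "adj E = {(x, y). {x, y} \<in> E}"

definition component :: "'a set \<Rightarrow> 'a set set \<Rightarrow> 'a \<Rightarrow> 'a set" where
  "component V E u = {v \<in> V. (u, v) \<in> (adj E)\<^sup>*}"

definition connected_graph :: "'a set \<Rightarrow> 'a set set \<Rightarrow> bool" where
  "connected_graph V E \<longleftrightarrow> (\<forall>u\<in>V. \<forall>v\<in>V. (u, v) \<in> (adj E)\<^sup>*)"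

definition edge_cut :: "'a set \<Rightarrow> 'a set set \<Rightarrow> 'a set set \<Rightarrow> bool" where
  "edge_cut V E R \<longleftrightarrow> R \<subseteq> E \<and> \<not> connected_graph V (E - R)"

definition rainbow_cut :: "'a set \<Rightarrow> 'a set set \<Rightarrow> ('a set \<Rightarrow> 'c) \<Rightarrow> 'a set set \<Rightarrow> bool" where
  "rainbow_cut V E c R \<longleftrightarrow> edge_cut V E R \<and> inj_on c R"

definition uv_rainbow_cut ::
  "'a set \<Rightarrow> 'a set set \<Rightarrow> ('a set \<Rightarrow> 'c) \<Rightarrow> 'a \<Rightarrow> 'a \<Rightarrow> 'a set set \<Rightarrow> bool" where
  "uv_rainbow_cut V E c u v R \<longleftrightarrow>
     rainbow_cut V E c R \<and> component V (E - R) u \<noteq> component V (E - R) v"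

definition rainbow_disconnected :: "'a set \<Rightarrow> 'a set set \<Rightarrow> ('a set \<Rightarrow> 'c) \<Rightarrow> bool" where
  "rainbow_disconnected V E c \<longleftrightarrow>
     (\<forall>u\<in>V. \<forall>v\<in>V. u \<noteq> v \<longrightarrow> (\<exists>R. uv_rainbow_cut V E c u v R))"

text \<open>The rainbow disconnection number. For a finite graph the minimum is over a nonempty set:
  if all edges receive different colors, then \<open>R = E\<close> separates any two vertices.\<close>

definition rd :: "'a set \<Rightarrow> 'a set set \<Rightarrow> nat" where
  "rd V E = (LEAST m. \<exists>c :: 'a set \<Rightarrow> nat. card (c ` E) = m \<and> rainbow_disconnected V E c)"

text \<open>\<open>G = (V, E)\<close> is a complete \<open>k\<close>-partite graph \<open>K\<close> with (nonempty) parts of sizes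
  \<open>ns 1, \<dots>, ns k\<close>; the values of \<open>ns\<close> outside \<open>{1..k}\<close> are irrelevant.\<close>

definition complete_multipartite ::
  "'a set \<Rightarrow> 'a set set \<Rightarrow> nat \<Rightarrow> (nat \<Rightarrow> nat) \<Rightarrow> bool" where
  "complete_multipartite V E k ns \<longleftrightarrow>
     simple_graph V E \<and>
     (\<exists>P. disjoint_family_on P {1..k} \<and> V = (\<Union>i\<in>{1..k}. P i) \<and>
          (\<forall>i\<in>{1..k}. P i \<noteq> {} \<and> card (P i) = ns i) \<and>
          E = {{u, v} | u v. \<exists>i\<in>{1..k}. \<exists>j\<in>{1..k}. i \<noteq> j \<and> u \<in> P i \<and> v \<in> P j})"

end

theory Submission
  imports Defs "HOL-Combinatorics.Transposition"
begin

text \<open>Lower bound: a cut separating \<open>u\<close> and \<open>v\<close> contains the edge \<open>uv\<close>, if present, and an edge of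
  every path \<open>u w v\<close>; apply this to two vertices of largest degree. Upper bound: fix a vertex
  \<open>x\<close> of the smallest part \<open>A\<close>, and let \<open>K\<close> be the claimed value. In \<open>G - x\<close> all degrees are at
  most \<open>K\<close>, and those outside the independent set \<open>A\<close> are smaller than \<open>K\<close>, so Vizing's fan
  argument yields a proper edge colouring with \<open>K\<close> colours. Colour each edge \<open>xv\<close> with a colour
  free at \<open>v\<close>. Then all edges at any vertex other than \<open>x\<close> have distinct colours, and of any two
  vertices at least one is different from \<open>x\<close>.\<close>

section \<open>Proper edge colourings\<close>

definition star :: "'a set set \<Rightarrow> 'a \<Rightarrow> 'a set set" where
  "star E v = {e \<in> E. v \<in> e}"

definition proper_colouring :: "'c set \<Rightarrow> ('a set \<Rightarrow> 'c) \<Rightarrow> 'a set set \<Rightarrow> bool" where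
  "proper_colouring C f E \<longleftrightarrow> f ` E \<subseteq> C \<and> (\<forall>v. inj_on f (star E v))"

definition free_colours :: "'c set \<Rightarrow> ('a set \<Rightarrow> 'c) \<Rightarrow> 'a set set \<Rightarrow> 'a \<Rightarrow> 'c set" where
  "free_colours C f E v = C - f ` star E v"

lemma star_subset: "star E v \<subseteq> E"
  by (auto simp: star_def)

lemma finite_star: "finite E \<Longrightarrow> finite (star E v)"
  by (simp add: star_def)

lemma edge_at_cases:
  assumes "card e = 2" "v \<in> e"
  obtains w where "e = {v, w}" "w \<noteq> v"
  using assms by (auto simp: card_2_iff)

lemma free_colours_nonempty:
  assumes "finite E" "card (star E v) < card C"
  shows "free_colours C f E v \<noteq> {}"
proof
  assume "free_colours C f E v = {}"
  then have "C \<subseteq> f ` star E v" by (auto simp: free_colours_def)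
  then have "card C \<le> card (star E v)"
    by (meson assms(1) finite_star surj_card_le)
  with assms(2) show False by simp
qed

text \<open>The new colour can clash with another edge only at \<open>x\<close> or \<open>y\<close>,
  and \<open>\<alpha>\<close> is free at both.\<close>

lemma proper_colouring_insert:
  assumes f: "proper_colouring C f (E - {{x, y}})"
    and \<alpha>: "\<alpha> \<in> free_colours C f (E - {{x, y}}) x" "\<alpha> \<in> free_colours C f (E - {{x, y}}) y"
  shows "proper_colouring C (f({x, y} := \<alpha>)) E"
proof -
  have "inj_on (f({x, y} := \<alpha>)) (star E v)" for v
  proof (rule inj_onI)
    fix d e assume de: "d \<in> star E v" "e \<in> star E v"
      and eq: "(f({x, y} := \<alpha>)) d = (f({x, y} := \<alpha>)) e"
    have inj: "inj_on f (star (E - {{x, y}}) v)"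
      using f by (simp add: proper_colouring_def)
    have new: "f e' \<noteq> \<alpha>" if "e' \<in> star E v" "e' \<noteq> {x, y}" "v \<in> {x, y}" for e'
      using that \<alpha> by (auto simp: free_colours_def star_def)
    show "d = e"
    proof (cases "d = {x, y} \<or> e = {x, y}")
      case True
      with de have "v \<in> {x, y}" by (auto simp: star_def)
      with True de eq new show ?thesis by (metis fun_upd_apply)
    next
      case False
      then have "d \<in> star (E - {{x, y}}) v" "e \<in> star (E - {{x, y}}) v" "f d = f e"
        using de eq by (auto simp: star_def)
      with inj show ?thesis by (auto dest: inj_onD)
    qed
  qed
  with f \<alpha> show ?thesis
    by (auto simp: proper_colouring_def free_colours_def)
qed

section \<open>Kempe chains\<close>

text \<open>The orbit of \<open>x\<close> is the alternating walk \<open>x, b x, a (b x), \<dots>\<close>, which turns back at the first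
  place where it stands still; a fixed point of \<open>b\<close> can only occur there.\<close>

lemma involutions_orbit:
  fixes a b :: "'a \<Rightarrow> 'a"
  assumes aa: "\<And>v. a (a v) = v" and bb: "\<And>v. b (b v) = v" and x: "a x = x"
  obtains S where "x \<in> S" "\<And>v. v \<in> S \<Longrightarrow> a v \<in> S" "\<And>v. v \<in> S \<Longrightarrow> b v \<in> S"
    "\<And>y z. y \<in> S \<Longrightarrow> z \<in> S \<Longrightarrow> b y = y \<Longrightarrow> b z = z \<Longrightarrow> y = z"
proof -
  define w where "w = rec_nat x (\<lambda>i. if even i then b else a)"
  have w0: "w 0 = x" and wS: "\<And>i. w (Suc i) = (if even i then b else a) (w i)"
    by (auto simp: w_def)
  \<comment> \<open>An initial segment of the naturals: the indices up to and including the first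
    one at which the walk stands still, or all indices if it never does.\<close>
  define I where "I = {i. \<forall>j<i. w (Suc j) \<noteq> w j}"
  have I0: "0 \<in> I" by (simp add: I_def)
  have I_up: "w (Suc i) \<in> w ` I" if "i \<in> I" for i
    using that by (cases "w (Suc i) = w i") (auto simp: I_def less_Suc_eq intro!: imageI)
  have I_down: "i \<in> I" if "Suc i \<in> I" for i
    using that by (auto simp: I_def)
  have a_closed: "a (w i) \<in> w ` I" if i: "i \<in> I" for i
  proof (cases "even i")
    case False
    with I_up[OF i] show ?thesis by (simp add: wS)
  next
    case True
    show ?thesis
    proof (cases i)
      \<comment> \<open>The start has no predecessor on the walk to return to;
        \<open>a x = x\<close> closes the orbit here.\<close>
      case 0
      with I0 w0 x show ?thesis by (metis imageI)
    next
      case (Suc j)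
      with True aa have "a (w i) = w j" by (simp add: wS)
      with I_down i Suc show ?thesis by auto
    qed
  qed
  have b_closed: "b (w i) \<in> w ` I" if i: "i \<in> I" for i
  proof (cases "even i")
    case True
    with I_up[OF i] show ?thesis by (simp add: wS)
  next
    case False
    then obtain j where j: "i = Suc j" by (cases i) auto
    with False bb have "b (w i) = w j" by (simp add: wS)
    with I_down i j show ?thesis by auto
  qed
  \<comment> \<open>For even \<open>i\<close> the next step is by \<open>b\<close>. For odd
    \<open>i\<close> the step that reached \<open>w i\<close> was by \<open>b\<close>, so the walk
    would have stood still before \<open>i\<close>, against \<open>i \<in> I\<close>.\<close>
  have stop: "w (Suc i) = w i" if i: "i \<in> I" and fixed: "b (w i) = w i" for i
  proof (cases "even i")
    case True
    with fixed show ?thesis by (simp add: wS)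
  next
    case False
    then obtain j where j: "i = Suc j" by (cases i) auto
    with False bb fixed have "w (Suc j) = w j" by (simp add: wS)
    with i j show ?thesis by (simp add: I_def)
  qed
  have uniq: "i = l" if "i \<in> I" "l \<in> I" "b (w i) = w i" "b (w l) = w l" for i l
  proof -
    have "w (Suc i) = w i" "w (Suc l) = w l" using that stop by auto
    with that(1,2) have "\<not> i < l" "\<not> l < i" by (auto simp: I_def)
    then show ?thesis by simp
  qed
  show thesis
  proof (rule that[of "w ` I"])
    show "x \<in> w ` I" using I0 w0 by (metis imageI)
    show "a v \<in> w ` I" "b v \<in> w ` I" if "v \<in> w ` I" for v
      using that a_closed b_closed by blast+
    show "y = z" if "y \<in> w ` I" "z \<in> w ` I" "b y = y" "b z = z" for y z
      using that uniq by blast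
  qed
qed

text \<open>In a proper colouring a colour class is a matching; this turns it into a total
  involution that exchanges the ends of its edges and fixes every vertex missing the colour. Two
  colours give the two involutions of an alternating chain.\<close>

definition partner :: "('a set \<Rightarrow> 'c) \<Rightarrow> 'a set set \<Rightarrow> 'c \<Rightarrow> 'a \<Rightarrow> 'a" where
  "partner f E \<alpha> v = (if \<exists>w. {v, w} \<in> E \<and> f {v, w} = \<alpha>
     then SOME w. {v, w} \<in> E \<and> f {v, w} = \<alpha> else v)"

lemma partner_eq:
  assumes "proper_colouring C f E" "{v, w} \<in> E" "f {v, w} = \<alpha>"
  shows "partner f E \<alpha> v = w"
proof -
  have uniq: "u = w" if "{v, u} \<in> E" "f {v, u} = \<alpha>" for u
  proof -
    have "inj_on f (star E v)" using assms by (simp add: proper_colouring_def)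
    then have "{v, u} = {v, w}" by (rule inj_onD) (use assms that in \<open>auto simp: star_def\<close>)
    then show ?thesis by (auto simp: doubleton_eq_iff)
  qed
  have "(SOME u. {v, u} \<in> E \<and> f {v, u} = \<alpha>) = w"
    by (rule some_equality) (use assms uniq in blast)+
  moreover have "\<exists>w. {v, w} \<in> E \<and> f {v, w} = \<alpha>" using assms by blast
  ultimately show ?thesis by (simp only: partner_def if_True)
qed

lemma partner_free: "\<alpha> \<in> free_colours C f E v \<Longrightarrow> partner f E \<alpha> v = v"
  by (auto simp: partner_def free_colours_def star_def)

lemma partner_partner:
  assumes "proper_colouring C f E"
  shows "partner f E \<alpha> (partner f E \<alpha> v) = v"
proof (cases "\<exists>w. {v, w} \<in> E \<and> f {v, w} = \<alpha>")
  case True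
  then obtain w where w: "{v, w} \<in> E" "f {v, w} = \<alpha>" by auto
  then have "partner f E \<alpha> v = w" by (rule partner_eq[OF assms])
  moreover have "partner f E \<alpha> w = v"
    using w by (intro partner_eq[OF assms]) (auto simp: insert_commute)
  ultimately show ?thesis by simp
next
  case False
  then show ?thesis by (auto simp: partner_def)
qed

text \<open>Edges leaving \<open>S\<close> have colours other than \<open>\<alpha>\<close> and
  \<open>\<beta>\<close>, which the transposition fixes. So at a vertex of \<open>S\<close> all
  colours are permuted and at any other vertex all are kept; either way they stay distinct.\<close>

lemma kempe_swap:
  assumes f: "proper_colouring C f E" and \<alpha>\<beta>: "\<alpha> \<in> C" "\<beta> \<in> C"
    and closed: "\<And>e. e \<in> E \<Longrightarrow> f e \<in> {\<alpha>, \<beta>} \<Longrightarrow> e \<subseteq> S \<or> e \<inter> S = {}"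
  obtains g where "proper_colouring C g E"
    "\<And>e v. e \<in> star E v \<Longrightarrow> v \<notin> S \<Longrightarrow> g e = f e"
    "\<And>v. v \<notin> S \<Longrightarrow> free_colours C g E v = free_colours C f E v"
    "\<And>v. v \<in> S \<Longrightarrow> free_colours C g E v = transpose \<alpha> \<beta> ` free_colours C f E v"
proof
  define g where "g e = (if e \<inter> S = {} then f e else transpose \<alpha> \<beta> (f e))" for e
  have out: "g e = f e" if "e \<in> star E v" "v \<notin> S" for e v
    using that closed[of e] by (auto simp: g_def star_def transpose_def)
  have ins: "g e = transpose \<alpha> \<beta> (f e)" if "e \<in> star E v" "v \<in> S" for e v
    using that by (auto simp: g_def star_def)
  have inj: "inj_on f (star E v)" for v
    using f by (simp add: proper_colouring_def)
  have "inj_on g (star E v)" for v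
  proof (cases "v \<in> S")
    case True
    have "inj_on (transpose \<alpha> \<beta> \<circ> f) (star E v)"
      using inj by (rule comp_inj_on) (rule inj_on_subset[OF inj_transpose subset_UNIV])
    then show ?thesis
      by (rule inj_on_cong[THEN iffD1, rotated]) (simp add: ins True)
  next
    case False
    show ?thesis
      by (rule inj_on_cong[THEN iffD1, OF _ inj]) (simp add: out False)
  qed
  moreover have "g ` E \<subseteq> C"
    using f \<alpha>\<beta> by (auto simp: g_def proper_colouring_def transpose_def)
  ultimately show "proper_colouring C g E" by (simp add: proper_colouring_def)
  show "g e = f e" if "e \<in> star E v" "v \<notin> S" for e v using out that .
  show "free_colours C g E v = free_colours C f E v" if "v \<notin> S" for v
    using out that by (auto simp: free_colours_def)
  show "free_colours C g E v = transpose \<alpha> \<beta> ` free_colours C f E v" if "v \<in> S" for v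
  proof -
    have "g ` star E v = transpose \<alpha> \<beta> ` (f ` star E v)"
      using ins that by (simp add: image_image)
    moreover have "transpose \<alpha> \<beta> ` C = C"
      using \<alpha>\<beta> by simp
    ultimately show ?thesis
      by (metis free_colours_def image_set_diff inj_transpose)
  qed
qed

section \<open>Vizing fans\<close>

text \<open>The edge from the centre \<open>x\<close> to the head of \<open>ys\<close> is the uncoloured one.\<close>

definition fan :: "'c set \<Rightarrow> 'a set set \<Rightarrow> 'a \<Rightarrow> ('a set \<Rightarrow> 'c) \<Rightarrow> 'a list \<Rightarrow> bool" where
  "fan C E x f ys \<longleftrightarrow> ys \<noteq> [] \<and> distinct ys \<and> x \<notin> set ys \<and> (\<forall>y\<in>set ys. {x, y} \<in> E) \<and>
     proper_colouring C f (E - {{x, hd ys}}) \<and>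
     successively (\<lambda>p q. f {x, q} \<in> free_colours C f (E - {{x, hd ys}}) p) ys"

text \<open>The colour of \<open>{x, z}\<close> moves to \<open>{x, y}\<close>. At \<open>x\<close>
  it only changes its edge, so the free colours there stay the same; the remaining fan vertices do
  not lie on \<open>{x, y}\<close>, so none of them loses a free colour.\<close>

lemma fan_rotate:
  assumes fan: "fan C E x f (y # z # zs)" and g: "g = f({x, y} := f {x, z})"
  shows "fan C E x g (z # zs)"
    and "free_colours C g (E - {{x, z}}) x = free_colours C f (E - {{x, y}}) x"
    and "v \<in> set (z # zs) \<Longrightarrow>
      free_colours C f (E - {{x, y}}) v \<subseteq> free_colours C g (E - {{x, z}}) v"
    and "v \<in> set (z # zs) \<Longrightarrow> g {x, v} = f {x, v}"
proof -
  have dist: "y \<noteq> z" "y \<notin> set zs" "x \<noteq> y" "x \<noteq> z" "x \<notin> set zs" "z \<notin> set zs" "distinct zs"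
    and E: "{x, y} \<in> E" "{x, z} \<in> E" "\<forall>y\<in>set zs. {x, y} \<in> E"
    and f: "proper_colouring C f (E - {{x, y}})"
    and free: "f {x, z} \<in> free_colours C f (E - {{x, y}}) y"
    and succ: "successively (\<lambda>p q. f {x, q} \<in> free_colours C f (E - {{x, y}}) p) (z # zs)"
    using fan by (auto simp: fan_def)
  have ne: "{x, z} \<noteq> {x, y}" using dist by (auto simp: doubleton_eq_iff)
  show sub: "free_colours C f (E - {{x, y}}) v \<subseteq> free_colours C g (E - {{x, z}}) v"
    if "v \<in> set (z # zs)" for v
  proof -
    have "v \<notin> {x, y}" using that dist by auto
    then show ?thesis by (auto simp: free_colours_def star_def g)
  qed
  show keep: "g {x, v} = f {x, v}" if "v \<in> set (z # zs)" for v
  proof -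
    have "{x, v} \<noteq> {x, y}" using that dist by (auto simp: doubleton_eq_iff)
    then show ?thesis by (simp add: g)
  qed
  \<comment> \<open>Both stars of \<open>x\<close> are a common rest plus one edge, and that edge
    has the colour \<open>f {x, z}\<close> before and after the rotation.\<close>
  have "star (E - {{x, y}}) x = insert {x, z} (star (E - {{x, y}, {x, z}}) x)"
    "star (E - {{x, z}}) x = insert {x, y} (star (E - {{x, y}, {x, z}}) x)"
    using E ne by (auto simp: star_def)
  moreover have "g ` star (E - {{x, y}, {x, z}}) x = f ` star (E - {{x, y}, {x, z}}) x"
    by (intro image_cong) (auto simp: star_def g)
  ultimately show "free_colours C g (E - {{x, z}}) x = free_colours C f (E - {{x, y}}) x"
    by (simp add: free_colours_def g del: fun_upd_apply) (simp)
  have "proper_colouring C g (E - {{x, z}})"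
    unfolding g
  proof (rule proper_colouring_insert)
    have "star (E - {{x, z}} - {{x, y}}) v \<subseteq> star (E - {{x, y}}) v" for v
      by (auto simp: star_def)
    then have "inj_on f (star (E - {{x, z}} - {{x, y}}) v)" for v
      using f unfolding proper_colouring_def by (meson inj_on_subset)
    then show "proper_colouring C f (E - {{x, z}} - {{x, y}})"
      using f by (auto simp: proper_colouring_def)
    show "f {x, z} \<in> free_colours C f (E - {{x, z}} - {{x, y}}) y"
      using free by (auto simp: free_colours_def star_def)
    \<comment> \<open>Properness at \<open>x\<close> makes \<open>{x, z}\<close> the only edge there
      with its colour, so uncolouring it frees the colour at \<open>x\<close>.\<close>
    have "inj_on f (star (E - {{x, y}}) x)" "{x, z} \<in> star (E - {{x, y}}) x"
      using f E ne by (auto simp: proper_colouring_def star_def)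
    then have "f {x, z} \<notin> f ` star (E - {{x, z}} - {{x, y}}) x"
      by (auto simp: inj_on_def star_def)
    then show "f {x, z} \<in> free_colours C f (E - {{x, z}} - {{x, y}}) x"
      using free by (auto simp: free_colours_def)
  qed
  moreover have "successively (\<lambda>p q. g {x, q} \<in> free_colours C g (E - {{x, z}}) p) (z # zs)"
    using succ by (rule successively_mono) (use sub keep in auto)
  ultimately show "fan C E x g (z # zs)"
    using dist E by (auto simp: fan_def)
qed

text \<open>Repeated rotation along \<open>us\<close> makes \<open>{x, w}\<close> the uncoloured
  edge. The term \<open>hd (us @ [w])\<close> is the head of the original fan, also for empty
  \<open>us\<close>.\<close>

lemma fan_rotate_prefix:
  assumes "fan C E x f (us @ w # ws)"
  obtains g where "fan C E x g (w # ws)"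
    "free_colours C g (E - {{x, w}}) x = free_colours C f (E - {{x, hd (us @ [w])}}) x"
    "\<And>v. v \<in> set (w # ws) \<Longrightarrow>
      free_colours C f (E - {{x, hd (us @ [w])}}) v \<subseteq> free_colours C g (E - {{x, w}}) v"
    "\<And>v. v \<in> set (w # ws) \<Longrightarrow> g {x, v} = f {x, v}"
  using assms
proof (induction us arbitrary: f thesis)
  case Nil
  then show ?case by auto
next
  case (Cons y us)
  obtain z zs where z: "us @ w # ws = z # zs" by (cases us) auto
  then have hd: "hd (us @ [w]) = z" by (cases us) auto
  have sub: "set (w # ws) \<subseteq> set (z # zs)" unfolding z[symmetric] by auto
  define h where "h = f({x, y} := f {x, z})"
  have "fan C E x f (y # z # zs)" using Cons.prems z by simp
  note rot = fan_rotate[OF this h_def]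
  obtain g where "fan C E x g (w # ws)"
    "free_colours C g (E - {{x, w}}) x = free_colours C h (E - {{x, z}}) x"
    "\<And>v. v \<in> set (w # ws) \<Longrightarrow>
      free_colours C h (E - {{x, z}}) v \<subseteq> free_colours C g (E - {{x, w}}) v"
    "\<And>v. v \<in> set (w # ws) \<Longrightarrow> g {x, v} = h {x, v}"
    using Cons.IH[of h] rot(1) z hd by metis
  with rot sub show ?case
    by (intro Cons.prems(1)[of g]) (simp_all only: hd append_Cons list.sel, blast+)
qed

text \<open>Rotating the whole fan leaves only the edge to the last vertex uncoloured. Its two ends
  still share the free colour \<open>\<alpha>\<close>, which can be put on it.\<close>

lemma fan_common_free:
  assumes fan: "fan C E x f ys"
    and "\<alpha> \<in> free_colours C f (E - {{x, hd ys}}) x"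
    and "\<alpha> \<in> free_colours C f (E - {{x, hd ys}}) (last ys)"
  shows "\<exists>g. proper_colouring C g E"
proof -
  have ys: "ys = butlast ys @ [last ys]" using fan by (simp add: fan_def)
  obtain g where g: "fan C E x g [last ys]"
    "free_colours C g (E - {{x, last ys}}) x = free_colours C f (E - {{x, hd ys}}) x"
    "free_colours C f (E - {{x, hd ys}}) (last ys) \<subseteq> free_colours C g (E - {{x, last ys}}) (last ys)"
    using fan_rotate_prefix[of C E x f "butlast ys" "last ys" "[]"] fan ys
    by (metis list.set_intros(1))
  then have "proper_colouring C (g({x, last ys} := \<alpha>)) E"
    using assms by (intro proper_colouring_insert) (auto simp: fan_def)
  then show ?thesis by blast
qed

text \<open>A fan in which the colour \<open>\<beta>\<close> of the first coloured edge is also free at the last vertex.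
  At most one of \<open>p\<close> and the last vertex lies on the \<open>\<alpha>\<close>-\<open>\<beta>\<close>-chain of \<open>x\<close>, and swapping
  \<open>\<alpha>\<close> and \<open>\<beta>\<close> off that chain makes \<open>\<alpha>\<close> free at the other one.\<close>

lemma fan_closed:
  assumes card2: "\<And>e. e \<in> E \<Longrightarrow> card e = 2"
    and fan: "fan C E x f (p # z # zs)"
    and \<alpha>: "\<alpha> \<in> free_colours C f (E - {{x, p}}) x"
    and \<beta>: "f {x, z} = \<beta>" "\<beta> \<in> free_colours C f (E - {{x, p}}) (last (z # zs))"
  shows "\<exists>g. proper_colouring C g E"
proof -
  define F where "F = E - {{x, p}}"
  define l where "l = last (z # zs)"
  have l: "l \<in> set (z # zs)" by (simp add: l_def)
  have f: "proper_colouring C f F" and x: "x \<notin> set (p # z # zs)"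
    and dist: "distinct (p # z # zs)" and E: "\<And>q. q \<in> set (p # z # zs) \<Longrightarrow> {x, q} \<in> E"
    and \<beta>p: "\<beta> \<in> free_colours C f F p"
    and succ: "successively (\<lambda>p q. f {x, q} \<in> free_colours C f F p) (z # zs)"
    using fan \<beta> by (auto simp: fan_def F_def)
  have F: "{x, q} \<in> star F x" if "q \<in> set (z # zs)" for q
    using E[of q] that dist x by (auto simp: F_def star_def doubleton_eq_iff)
  have \<alpha>\<beta>C: "\<alpha> \<in> C" "\<beta> \<in> C" using \<alpha> \<beta> by (auto simp: free_colours_def)
  obtain S where S: "x \<in> S" "\<And>v. v \<in> S \<Longrightarrow> partner f F \<alpha> v \<in> S"
    "\<And>v. v \<in> S \<Longrightarrow> partner f F \<beta> v \<in> S"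
    and uniq: "\<And>y z. y \<in> S \<Longrightarrow> z \<in> S \<Longrightarrow> partner f F \<beta> y = y \<Longrightarrow> partner f F \<beta> z = z \<Longrightarrow> y = z"
    using involutions_orbit[of "partner f F \<alpha>" "partner f F \<beta>" x]
      partner_partner[OF f] partner_free[of \<alpha> C f F x] \<alpha> unfolding F_def by metis
  \<comment> \<open>Phrased for the complement of \<open>S\<close> because the swap takes place off
    the chain of \<open>x\<close>.\<close>
  have closed: "e \<subseteq> - S \<or> e \<inter> - S = {}" if e: "e \<in> F" "f e \<in> {\<alpha>, \<beta>}" for e
  proof -
    have "e \<subseteq> S" if "v \<in> e" "v \<in> S" for v
    proof -
      obtain w where w: "e = {v, w}"
        using edge_at_cases[of e v] card2 e \<open>v \<in> e\<close> by (auto simp: F_def)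
      then have "partner f F (f e) v = w" using e by (intro partner_eq[OF f]) auto
      moreover have "partner f F (f e) v \<in> S" using S(2,3)[OF \<open>v \<in> S\<close>] e by auto
      ultimately show ?thesis using \<open>v \<in> S\<close> w by simp
    qed
    then show ?thesis by blast
  qed
  obtain g where g: "proper_colouring C g F"
    and same: "\<And>e v. e \<in> star F v \<Longrightarrow> v \<in> S \<Longrightarrow> g e = f e"
    and free: "\<And>v. v \<in> S \<Longrightarrow> free_colours C g F v = free_colours C f F v"
      "\<And>v. v \<notin> S \<Longrightarrow> free_colours C g F v = transpose \<alpha> \<beta> ` free_colours C f F v"
    using kempe_swap[OF f \<alpha>\<beta>C closed] by (metis ComplI Compl_iff)
  have \<alpha>x: "\<alpha> \<in> free_colours C g F x" using free S \<alpha> by (simp add: F_def)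
  have move: "\<alpha> \<in> free_colours C g F v" if "\<beta> \<in> free_colours C f F v" "v \<notin> S" for v
    using that free(2)[of v] by (metis image_eqI transpose_apply_second)
  show ?thesis
  proof (cases "p \<in> S")
    case False
    \<comment> \<open>Here \<open>\<alpha>\<close> becomes free at \<open>p\<close>, so the
      one-vertex fan already suffices.\<close>
    have "fan C E x g [p]" using g x E by (auto simp: fan_def F_def)
    then show ?thesis
      by (rule fan_common_free[of _ _ _ _ _ \<alpha>]) (use \<alpha>x move[OF \<beta>p False] in \<open>auto simp: F_def\<close>)
  next
    case True
    have "\<beta> \<in> free_colours C f F l" using \<beta> by (simp add: F_def l_def)
    moreover have "l \<noteq> p" using l dist by auto
    \<comment> \<open>Both \<open>p\<close> and \<open>l\<close> miss \<open>\<beta>\<close>, so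
      they are fixed points of the \<open>\<beta>\<close>-involution, and the orbit contains at most
      one such point.\<close>
    ultimately have "l \<notin> S"
      using uniq[OF True, of l] partner_free \<beta>p by metis
    with move \<open>\<beta> \<in> free_colours C f F l\<close> have \<alpha>l: "\<alpha> \<in> free_colours C g F l" by blast
    have gx: "g {x, q} = f {x, q}" if "q \<in> set (z # zs)" for q
      using same[OF F[OF that]] S by blast
    \<comment> \<open>The fan conditions after \<open>z\<close> survive the swap: no edge
      \<open>{x, q}\<close> has colour \<open>\<alpha>\<close>, which is free at \<open>x\<close>,
      and only \<open>{x, z}\<close> has colour \<open>\<beta>\<close>. All other colours are fixed
      by the transposition.\<close>
    have step: "g {x, q} \<in> free_colours C g F v"
      if q: "q \<in> set zs" and v: "f {x, q} \<in> free_colours C f F v" for v q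
    proof -
      have "f {x, q} \<noteq> \<alpha>"
        using \<alpha> F[of q] q by (auto simp: free_colours_def F_def)
      moreover have "f {x, q} \<noteq> \<beta>"
      proof
        assume "f {x, q} = \<beta>"
        then have "{x, q} = {x, z}"
          using f F[of q] F[of z] q \<beta> by (auto simp: proper_colouring_def dest!: inj_onD)
        then show False using q dist by (auto simp: doubleton_eq_iff)
      qed
      ultimately have "f {x, q} \<in> free_colours C g F v"
        using v free[of v] by (metis image_eqI transpose_apply_other)
      then show ?thesis using gx q by simp
    qed
    have "successively (\<lambda>p q. g {x, q} \<in> free_colours C g F p) (z # zs)"
      using succ step by (cases zs) (auto elim!: successively_mono)
    moreover have "g {x, z} \<in> free_colours C g F p"
      using gx[of z] \<beta> \<beta>p free(1)[OF True] by simp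
    ultimately have "fan C E x g (p # z # zs)"
      using g dist x E by (auto simp: fan_def F_def)
    then show ?thesis
      by (rule fan_common_free[of _ _ _ _ _ \<alpha>]) (use \<alpha>x \<alpha>l in \<open>auto simp: F_def l_def\<close>)
  qed
qed

section \<open>Extending a colouring edge by edge\<close>

text \<open>Take a longest fan starting at \<open>y\<close> and a colour \<open>\<beta>\<close> free
  at its last vertex. If \<open>\<beta>\<close> is free at \<open>x\<close>, the whole fan is
  rotated; otherwise the edge at \<open>x\<close> coloured \<open>\<beta>\<close> ends inside the
  fan by maximality, and \<open>fan_closed\<close> applies. The centre may have degree
  \<open>card C\<close>, as its uncoloured edge leaves a colour free.\<close>

lemma vizing_extend:
  assumes fin: "finite E" and card2: "\<And>e. e \<in> E \<Longrightarrow> card e = 2"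
    and xy: "{x, y} \<in> E" and f: "proper_colouring C f (E - {{x, y}})"
    and degx: "card (star E x) \<le> card C"
    and deg: "\<And>z. {x, z} \<in> E \<Longrightarrow> card (star E z) < card C"
  shows "\<exists>g. proper_colouring C g E"
proof -
  define F where "F = E - {{x, y}}"
  define N where "N = {z. {x, z} \<in> E}"
  have finF: "finite F" using fin by (simp add: F_def)
  have xN: "z \<noteq> x" if "z \<in> N" for z
    using card2[of "{x, z}"] that by (auto simp: N_def)
  have "finite N"
  proof (rule finite_subset)
    show "N \<subseteq> \<Union>E" by (auto simp: N_def)
    show "finite (\<Union>E)" using fin card2 by (intro finite_Union) (auto intro: card_ge_0_finite)
  qed
  have "card (star F x) < card (star E x)"
    using xy by (intro psubset_card_mono finite_star fin) (auto simp: F_def star_def)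
  then obtain \<alpha> where \<alpha>: "\<alpha> \<in> free_colours C f F x"
    using free_colours_nonempty[OF finF, of x C f] degx by auto
  define P where "P ys \<longleftrightarrow> fan C E x f ys \<and> hd ys = y" for ys
  have len: "length ys \<le> card N" if "P ys" for ys
  proof -
    have "length ys = card (set ys)"
      using that unfolding P_def fan_def by (metis distinct_card)
    also have "\<dots> \<le> card N"
      using that by (intro card_mono \<open>finite N\<close>) (auto simp: P_def fan_def N_def)
    finally show ?thesis .
  qed
  have "P [y]" using xy f xN[of y] by (auto simp: P_def fan_def N_def)
  with len obtain ys where ys: "P ys" and max: "\<And>zs. P zs \<Longrightarrow> length zs \<le> length ys"
    using ex_has_greatest_nat[of P "[y]" length "Suc (card N)"] by (metis le_imp_less_Suc)
  have fan: "fan C E x f ys" and hd: "hd ys = y" and ne: "ys \<noteq> []" and dist: "distinct ys"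
    using ys by (auto simp: P_def fan_def)
  have "last ys \<in> N" using fan by (auto simp: fan_def N_def)
  then have "card (star E (last ys)) < card C" using deg by (simp add: N_def)
  moreover have "card (star F (last ys)) \<le> card (star E (last ys))"
    by (intro card_mono finite_star fin) (auto simp: F_def star_def)
  ultimately obtain \<beta> where \<beta>: "\<beta> \<in> free_colours C f F (last ys)"
    using free_colours_nonempty[OF finF, of "last ys" C f] by fastforce
  show ?thesis
  proof (cases "\<beta> \<in> free_colours C f F x")
    case True
    with \<beta> hd show ?thesis by (intro fan_common_free[OF fan]) (auto simp: F_def)
  next
    case False
    with \<beta> obtain e where e: "e \<in> star F x" "f e = \<beta>" by (auto simp: free_colours_def)
    then have "card e = 2" "x \<in> e" using card2 by (auto simp: F_def star_def)
    then obtain z where z: "e = {x, z}" by (rule edge_at_cases)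
    have zN: "z \<in> N" and zy: "z \<noteq> y" using e z by (auto simp: N_def F_def star_def)
    have "z \<in> set ys"
    proof (rule ccontr)
      assume "z \<notin> set ys"
      \<comment> \<open>The colour \<open>\<beta>\<close> of \<open>{x, z}\<close> is free at the
        last vertex, so \<open>z\<close> would prolong the fan.\<close>
      then have "P (ys @ [z])"
        using fan hd ne \<beta> e z zN xN[OF zN]
        by (auto simp: P_def fan_def successively_append_iff N_def F_def)
      with max show False by fastforce
    qed
    then obtain us zs where us: "ys = us @ z # zs" by (auto dest: split_list)
    with hd zy have "us \<noteq> []" by auto
    \<comment> \<open>Since \<open>z\<close> is not the head \<open>y\<close>, it has a predecessor
      \<open>p\<close>; rotating up to \<open>p\<close> puts \<open>\<beta>\<close> on the first
      coloured edge of the rest.\<close>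
    then obtain pre p where pre: "us = pre @ [p]" by (metis append_butlast_last_id)
    have "fan C E x f (pre @ p # z # zs)" using fan us pre by simp
    then obtain g where g: "fan C E x g (p # z # zs)"
      "free_colours C g (E - {{x, p}}) x = free_colours C f (E - {{x, hd (pre @ [p])}}) x"
      "\<And>v. v \<in> set (p # z # zs) \<Longrightarrow>
        free_colours C f (E - {{x, hd (pre @ [p])}}) v \<subseteq> free_colours C g (E - {{x, p}}) v"
      "\<And>v. v \<in> set (p # z # zs) \<Longrightarrow> g {x, v} = f {x, v}"
      by (rule fan_rotate_prefix) blast
    have hd': "hd (pre @ [p]) = y" using hd us pre by (cases pre) auto
    have last: "last ys = last (z # zs)" "last (z # zs) \<in> set (p # z # zs)" using us by auto
    show ?thesis
    proof (rule fan_closed[OF card2 g(1)])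
      show "\<alpha> \<in> free_colours C g (E - {{x, p}}) x"
        using \<alpha> g(2) hd' by (simp add: F_def)
      show "g {x, z} = \<beta>" using g(4)[of z] e z by simp
      show "\<beta> \<in> free_colours C g (E - {{x, p}}) (last (z # zs))"
        using g(3)[OF last(2)] \<beta> hd' last(1) by (auto simp: F_def)
    qed
  qed
qed

text \<open>Edges at \<open>A\<close> are coloured last, each with its fan centred at the endpoint in \<open>A\<close>, so that
  all other vertices of the fan have a free colour.\<close>

theorem vizing_independent_core:
  assumes "finite E" and "\<And>e. e \<in> E \<Longrightarrow> card e = 2"
    and "\<And>u v. {u, v} \<in> E \<Longrightarrow> u \<in> A \<Longrightarrow> v \<notin> A"
    and "\<And>v. card (star E v) \<le> card C"
    and "\<And>v. v \<notin> A \<Longrightarrow> card (star E v) < card C"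
  shows "\<exists>f. proper_colouring C f E"
  using assms
proof (induction "card E" arbitrary: E rule: less_induct)
  case less
  note fin = less.prems(1) and card2 = less.prems(2) and indep = less.prems(3)
  show ?case
  proof (cases "E = {}")
    case True
    then show ?thesis by (simp add: proper_colouring_def star_def)
  next
    case False
    \<comment> \<open>Any edge meeting \<open>A\<close> is removed first, with \<open>x\<close> its
      end in \<open>A\<close>; independence keeps the neighbours of \<open>x\<close> out of
      \<open>A\<close>. Once no edge meets \<open>A\<close>, any edge will do.\<close>
    obtain x y where xy: "{x, y} \<in> E" and nb: "\<And>z. {x, z} \<in> E \<Longrightarrow> z \<notin> A"
    proof (cases "\<exists>x\<in>A. \<exists>y. {x, y} \<in> E")
      case True
      then show ?thesis using indep that by blast
    next
      case none: False
      from False obtain e where "e \<in> E" by blast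
      with card2 obtain x y where "{x, y} \<in> E" by (metis card_2_iff)
      with none show ?thesis by (intro that) (auto simp: insert_commute)
    qed
    have mono: "card (star (E - {{x, y}}) v) \<le> card (star E v)" for v
      by (intro card_mono finite_star fin) (auto simp: star_def)
    have "\<exists>f. proper_colouring C f (E - {{x, y}})"
    proof (rule less.hyps)
      show "card (E - {{x, y}}) < card E" using fin xy by (rule card_Diff1_less)
      show "card (star (E - {{x, y}}) v) \<le> card C" for v
        using mono less.prems(4) le_trans by blast
      show "card (star (E - {{x, y}}) v) < card C" if "v \<notin> A" for v
        using mono less.prems(5)[OF that] le_less_trans by blast
    qed (use fin card2 indep in auto)
    then obtain f where "proper_colouring C f (E - {{x, y}})" ..
    then show ?thesis
      using vizing_extend[OF fin card2 xy] less.prems(4,5) nb by blast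
  qed
qed

section \<open>Rainbow disconnection\<close>

lemma sym_adj: "sym (adj E)"
  by (auto simp: sym_def adj_def insert_commute)

text \<open>Deleting the star of a vertex isolates it, so an injectively coloured star is a rainbow
  cut. One exceptional vertex \<open>x\<close> is harmless: of two distinct vertices one is not
  \<open>x\<close>, and separation is symmetric.\<close>

lemma rainbow_disconnectedI:
  assumes "simple_graph V E" and inj: "\<And>v. v \<in> V \<Longrightarrow> v \<noteq> x \<Longrightarrow> inj_on c (star E v)"
  shows "rainbow_disconnected V E c"
  unfolding rainbow_disconnected_def
proof (intro ballI impI)
  fix u v assume uv: "u \<in> V" "v \<in> V" "u \<noteq> v"
  define w where "w = (if u = x then v else u)"
  define w' where "w' = (if u = x then u else v)"
  have w: "w \<in> V" "w' \<in> V" "w \<noteq> x" "w \<noteq> w'" "{u, v} = {w, w'}"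
    using uv by (auto simp: w_def w'_def)
  have no: "z = w" if "(w, z) \<in> (adj (E - star E w))\<^sup>*" for z
    using that by (cases rule: converse_rtranclE) (auto simp: adj_def star_def)
  have "rainbow_cut V E c (star E w)"
    unfolding rainbow_cut_def edge_cut_def connected_graph_def
    using star_subset no inj w by metis
  moreover have "component V (E - star E w) w \<noteq> component V (E - star E w) w'"
    using no w unfolding component_def by blast
  ultimately show "\<exists>R. uv_rainbow_cut V E c u v R"
    unfolding uv_rainbow_cut_def using w(5) by (metis doubleton_eq_iff)
qed

text \<open>A neighbour \<open>v\<close> of \<open>x\<close> lies outside \<open>A\<close>, so fewer
  than \<open>card C\<close> edges at \<open>v\<close> avoid \<open>x\<close>, and a colour remains
  for \<open>{x, v}\<close>. Colours may repeat at \<open>x\<close>, the exceptional vertex of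
  \<open>rainbow_disconnectedI\<close>.\<close>

lemma rd_le:
  fixes C :: "nat set"
  assumes G: "simple_graph V E" and C: "finite C"
    and indep: "\<And>u v. {u, v} \<in> E \<Longrightarrow> u \<in> A \<Longrightarrow> v \<notin> A"
    and deg: "\<And>v. card (star {e \<in> E. x \<notin> e} v) \<le> card C"
    and deg_less: "\<And>v. v \<notin> A \<Longrightarrow> card (star {e \<in> E. x \<notin> e} v) < card C"
    and x: "x \<in> A"
  shows "rd V E \<le> card C"
proof -
  define F where "F = {e \<in> E. x \<notin> e}"
  have card2: "card e = 2" if "e \<in> E" for e using G that by (simp add: simple_graph_def)
  have "E \<subseteq> Pow V" "finite V" using G by (auto simp: simple_graph_def)
  then have "finite E" by (metis finite_Pow_iff finite_subset)
  then have finF: "finite F" by (simp add: F_def)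
  have "\<exists>f. proper_colouring C f F"
    by (rule vizing_independent_core[where A = A]) (use finF card2 indep deg deg_less in \<open>auto simp: F_def\<close>)
  then obtain f where f: "proper_colouring C f F" ..
  define m where "m v = (SOME \<gamma>. \<gamma> \<in> free_colours C f F v)" for v
  have m: "m v \<in> free_colours C f F v" if "{x, v} \<in> E" for v
    unfolding m_def using free_colours_nonempty[OF finF, of v C f] deg_less indep[OF that x]
    by (simp add: F_def some_in_eq)
  \<comment> \<open>The \<open>THE\<close> term recovers the other end of an edge at
    \<open>x\<close>.\<close>
  define c where "c e = (if x \<in> e then m (THE v. e = {x, v}) else f e)" for e
  have cx: "c {x, v} = m v" for v
  proof -
    have "(THE w. {x, v} = {x, w}) = v" by (rule the_equality) (auto simp: doubleton_eq_iff)
    then show ?thesis by (simp add: c_def)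
  qed
  have inj: "inj_on c (star E v)" if v: "v \<noteq> x" for v
  proof (rule inj_onI)
    have at_x: "e = {x, v}" if "e \<in> star E v" "x \<in> e" for e
    proof -
      have "card e = 2" "v \<in> e" using that card2 by (auto simp: star_def)
      then obtain w where "e = {v, w}" by (rule edge_at_cases)
      with that v show ?thesis by auto
    qed
    have new: "c e \<noteq> c {x, v}" if "e \<in> star E v" "x \<notin> e" "{x, v} \<in> E" for e
    proof -
      have "e \<in> star F v" using that by (auto simp: star_def F_def)
      then have "f e \<in> f ` star F v" by (rule imageI)
      moreover have "c e = f e" using that by (simp add: c_def)
      ultimately show ?thesis using m[OF that(3)] by (auto simp: cx free_colours_def)
    qed
    fix d e assume de: "d \<in> star E v" "e \<in> star E v" "c d = c e"
    show "d = e"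
    proof (cases "x \<in> d \<or> x \<in> e")
      case True
      then have "{x, v} \<in> E" using de(1,2) at_x star_subset by (metis subsetD)
      with True de new[of d] new[of e] at_x[of d] at_x[of e] show ?thesis by force
    next
      case False
      then have "d \<in> star F v" "e \<in> star F v" "f d = f e"
        using de by (auto simp: F_def star_def c_def)
      with f show ?thesis by (auto simp: proper_colouring_def dest: inj_onD)
    qed
  qed
  have "c e \<in> C" if e: "e \<in> E" for e
  proof (cases "x \<in> e")
    case True
    with card2[OF e] obtain v where "e = {x, v}" by (rule edge_at_cases)
    with m e cx show ?thesis by (auto simp: free_colours_def)
  next
    case False
    with f e show ?thesis by (auto simp: c_def F_def proper_colouring_def)
  qed
  then have "card (c ` E) \<le> card C" using C by (intro card_mono) auto
  moreover have "rd V E \<le> card (c ` E)"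
    unfolding rd_def
    by (rule Least_le) (use rainbow_disconnectedI[OF G] inj in blast)
  ultimately show ?thesis by simp
qed

text \<open>The paths of length two through the common neighbours and the edge
  \<open>{u, v}\<close>, if present, are pairwise edge-disjoint. A rainbow cut contains an edge of
  each, and these edges have distinct colours.\<close>

lemma le_rd:
  assumes G: "simple_graph V E" and uv: "u \<in> V" "v \<in> V" "u \<noteq> v"
  shows "card {w. {u, w} \<in> E \<and> {w, v} \<in> E} + card (E \<inter> {{u, v}}) \<le> rd V E"
proof -
  define W where "W = {w. {u, w} \<in> E \<and> {w, v} \<in> E}"
  have EV: "e \<subseteq> V" "card e = 2" if "e \<in> E" for e using G that by (auto simp: simple_graph_def)
  have finV: "finite V" using G by (simp add: simple_graph_def)
  have "E \<subseteq> Pow V" using EV by auto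
  then have finE: "finite E" using finV by (metis finite_Pow_iff finite_subset)
  have "W \<subseteq> V" using EV(1) by (auto simp: W_def)
  then have finW: "finite W" using finV finite_subset by blast
  have Wuv: "w \<noteq> u" "w \<noteq> v" if "w \<in> W" for w
    using EV(2)[of "{u, w}"] EV(2)[of "{w, v}"] that by (auto simp: W_def)
  have bound: "card W + card (E \<inter> {{u, v}}) \<le> card (c ` E)"
    if c: "rainbow_disconnected V E c" for c :: "'a set \<Rightarrow> nat"
  proof -
    obtain R where "uv_rainbow_cut V E c u v R"
      using c uv by (auto simp: rainbow_disconnected_def)
    then have R: "R \<subseteq> E" "inj_on c R"
      and comp: "component V (E - R) u \<noteq> component V (E - R) v"
      by (auto simp: uv_rainbow_cut_def rainbow_cut_def edge_cut_def)
    have sep: "(u, v) \<notin> (adj (E - R))\<^sup>*"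
    proof
      assume "(u, v) \<in> (adj (E - R))\<^sup>*"
      moreover from this have "(v, u) \<in> (adj (E - R))\<^sup>*"
        using sym_rtrancl[OF sym_adj] by (meson symD)
      ultimately have "component V (E - R) u = component V (E - R) v"
        by (auto simp: component_def intro: rtrancl_trans)
      with comp show False by simp
    qed
    \<comment> \<open>Selects a cut edge on the path through \<open>w\<close>. As \<open>w\<close>
      differs from \<open>u\<close> and \<open>v\<close>, the chosen edge determines
      \<open>w\<close>.\<close>
    define h where "h w = (if {u, w} \<in> R then {u, w} else {w, v})" for w
    have hR: "h w \<in> R" if "w \<in> W" for w
    proof (rule ccontr)
      assume "h w \<notin> R"
      then have "(u, w) \<in> adj (E - R)" "(w, v) \<in> adj (E - R)"
        using that by (auto simp: h_def W_def adj_def split: if_splits)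
      with sep show False by (meson r_into_rtrancl rtrancl.rtrancl_into_rtrancl)
    qed
    have "inj_on h W"
      using Wuv by (auto simp: inj_on_def h_def doubleton_eq_iff split: if_splits)
    have "{u, v} \<in> R" if "{u, v} \<in> E"
      using sep that by (auto simp: adj_def)
    then have sub: "h ` W \<union> (E \<inter> {{u, v}}) \<subseteq> R" using hR by auto
    have disj: "h ` W \<inter> (E \<inter> {{u, v}}) = {}"
      using Wuv by (auto simp: h_def doubleton_eq_iff split: if_splits)
    have "card W + card (E \<inter> {{u, v}}) = card (h ` W \<union> (E \<inter> {{u, v}}))"
      using disj finW by (subst card_Un_disjoint) (auto simp: card_image[OF \<open>inj_on h W\<close>])
    also have "\<dots> \<le> card R"
      using sub R finE by (intro card_mono) (auto intro: finite_subset)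
    also have "\<dots> = card (c ` R)" using R by (simp add: card_image)
    also have "\<dots> \<le> card (c ` E)" using R finE by (intro card_mono) auto
    finally show ?thesis .
  qed
  \<comment> \<open>An injective colouring shows that the minimum ranges over a nonempty set, so
    \<open>rd V E\<close> is attained by some colouring.\<close>
  obtain c0 :: "'a set \<Rightarrow> nat" where "inj_on c0 E"
    using finite_imp_inj_to_nat_seg[OF finE] by blast
  then have "rainbow_disconnected V E c0"
    by (intro rainbow_disconnectedI[OF G]) (meson inj_on_subset star_subset)
  then have "\<exists>m. \<exists>c :: 'a set \<Rightarrow> nat. card (c ` E) = m \<and> rainbow_disconnected V E c" by metis
  from LeastI_ex[OF this]
  have "\<exists>c :: 'a set \<Rightarrow> nat. card (c ` E) = rd V E \<and> rainbow_disconnected V E c"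
    unfolding rd_def .
  then obtain c :: "'a set \<Rightarrow> nat" where "card (c ` E) = rd V E" "rainbow_disconnected V E c"
    by blast
  with bound[of c] show ?thesis by (simp add: W_def)
qed

section \<open>Complete multipartite graphs\<close>

theorem theorem1:
  fixes V :: "'a set" and E :: "'a set set" and k n :: nat and ns :: "nat \<Rightarrow> nat"
  assumes "k \<ge> 2"
    and "complete_multipartite V E k ns"
    and "card V = n"
    and "mono_on {1..k} ns"
  shows "(ns 1 = 1 \<longrightarrow> rd V E = n - ns 2) \<and> (ns 1 \<ge> 2 \<longrightarrow> rd V E = n - ns 1)"
proof -
  obtain P where G: "simple_graph V E" and disj: "disjoint_family_on P {1..k}"
    and V: "V = (\<Union>i\<in>{1..k}. P i)"
    and P: "\<And>i. i \<in> {1..k} \<Longrightarrow> P i \<noteq> {}" "\<And>i. i \<in> {1..k} \<Longrightarrow> card (P i) = ns i"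
    and E: "E = {{u, v} | u v. \<exists>i\<in>{1..k}. \<exists>j\<in>{1..k}. i \<noteq> j \<and> u \<in> P i \<and> v \<in> P j}"
    using assms(2) by (auto simp: complete_multipartite_def)
  have finV: "finite V" using G by (simp add: simple_graph_def)
  have k: "1 \<in> {1..k}" "2 \<in> {1..k}" using assms(1) by auto
  have same: "i = j" if "v \<in> P i" "v \<in> P j" "i \<in> {1..k}" "j \<in> {1..k}" for v i j
    using that disj unfolding disjoint_family_on_def by blast
  have PV: "P i \<subseteq> V" if "i \<in> {1..k}" for i using that V by auto
  have finP: "finite (P i)" if "i \<in> {1..k}" for i using finite_subset[OF PV[OF that] finV] .
  have edge: "{u, v} \<in> E \<longleftrightarrow> v \<in> V - P i" if u: "u \<in> P i" "i \<in> {1..k}" for u v i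
  proof
    assume "{u, v} \<in> E"
    then obtain a b p q where ab: "{u, v} = {a, b}" "p \<in> {1..k}" "q \<in> {1..k}" "p \<noteq> q"
      "a \<in> P p" "b \<in> P q" unfolding E mem_Collect_eq by metis
    then consider "u = a" "v = b" | "u = b" "v = a" unfolding doubleton_eq_iff by blast
    then obtain q' where q': "q' \<in> {1..k}" "v \<in> P q'" "q' \<noteq> i"
    proof cases
      case 1
      with ab u same[of u p i] show ?thesis by (intro that[of q]) auto
    next
      case 2
      with ab u same[of u q i] show ?thesis by (intro that[of p]) auto
    qed
    with same[of v q' i] u(2) PV show "v \<in> V - P i" by blast
  next
    assume "v \<in> V - P i"
    with V obtain j where "j \<in> {1..k}" "v \<in> P j" by blast
    with \<open>v \<in> V - P i\<close> u have "i \<noteq> j" by blast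
    with u \<open>j \<in> {1..k}\<close> \<open>v \<in> P j\<close> show "{u, v} \<in> E"
      unfolding E mem_Collect_eq by metis
  qed
  have n_diff: "card (V - P i) = n - ns i" if "i \<in> {1..k}" for i
    using that finP PV P assms(3) by (simp add: card_Diff_subset)
  have ns_le: "ns 1 \<le> ns i" if "i \<in> {1..k}" for i
    using assms(4) k that by (auto simp: mono_on_def)
  have ns2_le: "ns 2 \<le> ns i" if "i \<in> {1..k}" "i \<noteq> 1" for i
    using assms(4) k that by (auto simp: mono_on_def)
  obtain x where x: "x \<in> P 1" using P(1) k by blast
  have deg: "card (star {e \<in> E. x \<notin> e} v) \<le> card (V - P i - {x})"
    if v: "v \<in> P i" "i \<in> {1..k}" for v i
  proof -
    have "star {e \<in> E. x \<notin> e} v \<subseteq> (\<lambda>w. {v, w}) ` (V - P i - {x})"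
    proof
      fix e assume e: "e \<in> star {e \<in> E. x \<notin> e} v"
      then have "card e = 2" "v \<in> e" using G by (auto simp: star_def simple_graph_def)
      then obtain w where "e = {v, w}" by (rule edge_at_cases)
      with e edge[OF v] show "e \<in> (\<lambda>w. {v, w}) ` (V - P i - {x})" by (auto simp: star_def)
    qed
    with finV show ?thesis by (meson finite_Diff surj_card_le)
  qed
  have deg_other: "card (star {e \<in> E. x \<notin> e} v) < n - ns i"
    if v: "v \<in> P i" "i \<in> {1..k}" "i \<noteq> 1" for v i
  proof -
    \<comment> \<open>Vertices outside the first part are adjacent to \<open>x\<close>; its removal
      lowers their degree by one and makes the bound strict.\<close>
    have "x \<in> V - P i" using x same v k PV by blast
    then have "card (V - P i - {x}) < card (V - P i)"
      using finV by (intro card_Diff1_less) auto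
    with deg[OF v(1,2)] n_diff[OF v(2)] show ?thesis by simp
  qed
  have deg_out: "star {e \<in> E. x \<notin> e} v = {}" if "v \<notin> V \<or> v = x" for v
    using that G by (auto simp: star_def simple_graph_def)
  \<comment> \<open>Gives the strict degree bound at vertices outside \<open>V\<close>, and keeps
    the truncated subtraction \<open>n - ns 2 - 1\<close> exact.\<close>
  have pos: "0 < n - ns 2"
  proof -
    have "x \<in> V - P 2" using x same[of x 1 2] PV[of 1] k by auto
    with finV have "0 < card (V - P 2)" by (auto simp: card_gt_0_iff)
    with n_diff k show ?thesis by simp
  qed
  \<comment> \<open>Serves both cases with \<open>P 1\<close> as the independent set. Every other
    part has at least \<open>ns 2\<close> vertices, so only the degrees inside \<open>P 1\<close>
    remain to be bounded.\<close>
  have upper: "rd V E \<le> K"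
    if K: "n - ns 2 \<le> K" "\<And>v. v \<in> P 1 \<Longrightarrow> card (star {e \<in> E. x \<notin> e} v) \<le> K" for K
  proof -
    have other: "card (star {e \<in> E. x \<notin> e} v) < K" if "v \<notin> P 1" for v
    proof (cases "v \<in> V")
      case False
      with deg_out pos K show ?thesis by simp
    next
      case True
      with that V obtain i where i: "v \<in> P i" "i \<in> {1..k}" "i \<noteq> 1" by blast
      from deg_other[OF this] ns2_le[OF i(2,3)] K(1) show ?thesis by linarith
    qed
    have "rd V E \<le> card {..<K}"
    proof (rule rd_le[where A = "P 1" and x = x])
      show "card (star {e \<in> E. x \<notin> e} v) \<le> card {..<K}" for v
        using K(2)[of v] other[of v] by (cases "v \<in> P 1") auto
      show "card (star {e \<in> E. x \<notin> e} v) < card {..<K}" if "v \<notin> P 1" for v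
        using other[OF that] by simp
    qed (use G x edge[OF _ k(1)] in auto)
    then show ?thesis by simp
  qed
  show ?thesis
  proof (intro conjI impI)
    assume "ns 1 = 1"
    with P(2)[OF k(1)] x have P1: "P 1 = {x}" by (metis card_1_singletonE singletonD)
    obtain y where y: "y \<in> P 2" using P(1) k by blast
    have "x \<noteq> y" using x y same[of x 1 2] k by auto
    have "y \<in> V - P 1" using y P1 \<open>x \<noteq> y\<close> PV[OF k(2)] by auto
    then have "{x, y} \<in> E" using edge[OF x k(1)] by simp
    \<comment> \<open>This is one short of \<open>n - ns 2\<close>; the edge \<open>{x, y}\<close>
      itself supplies the missing one.\<close>
    have "{w. {x, w} \<in> E \<and> {w, y} \<in> E} = V - P 2 - {x}"
      using edge[OF x k(1)] edge[OF y k(2)] P1 by (auto simp: insert_commute)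
    moreover have "x \<in> V - P 2" using x same[of x 1 2] PV[of 1] k by auto
    ultimately have "card {w. {x, w} \<in> E \<and> {w, y} \<in> E} = n - ns 2 - 1"
      using n_diff[OF k(2)] finV by simp
    moreover have "E \<inter> {{x, y}} = {{x, y}}" using \<open>{x, y} \<in> E\<close> by auto
    moreover have "x \<in> V" "y \<in> V" using x y PV[OF k(1)] PV[OF k(2)] by auto
    ultimately have "n - ns 2 \<le> rd V E"
      using le_rd[OF G, of x y] \<open>x \<noteq> y\<close> pos by simp
    moreover have "rd V E \<le> n - ns 2"
      by (rule upper) (use P1 deg_out in auto)
    ultimately show "rd V E = n - ns 2" by simp
  next
    assume "2 \<le> ns 1"
    then have "P 1 \<noteq> {x}" using P(2)[OF k(1)] by auto
    with x obtain y where y: "y \<in> P 1" "x \<noteq> y" by blast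
    \<comment> \<open>Two vertices of the same part are nonadjacent and have all vertices of the
      other parts as common neighbours.\<close>
    have "{w. {x, w} \<in> E \<and> {w, y} \<in> E} = V - P 1"
      using edge[OF x k(1)] edge[OF y(1) k(1)] by (auto simp: insert_commute)
    moreover have "x \<in> V" "y \<in> V" using x y PV[OF k(1)] PV[OF k(2)] by auto
    ultimately have "n - ns 1 \<le> rd V E"
      using le_rd[OF G, of x y] y(2) n_diff[OF k(1)] by simp
    moreover have "rd V E \<le> n - ns 1"
    proof (rule upper)
      show "n - ns 2 \<le> n - ns 1" using ns_le[OF k(2)] by simp
      show "card (star {e \<in> E. x \<notin> e} v) \<le> n - ns 1" if "v \<in> P 1" for v
      proof -
        have "card (V - P 1 - {x}) \<le> card (V - P 1)" using finV by (intro card_mono) auto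
        with deg[OF that k(1)] n_diff[OF k(1)] show ?thesis by simp
      qed
    qed
    ultimately show "rd V E = n - ns 1" by simp
  qed
qed

end
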